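(* Fix $\alpha,\beta>0$. For $n\ge3$ let $S$ be a random $\alpha/\beta$-staircase tableau of size $n$ with law $\mathbb{P}_{n,\alpha,\beta}$, and let $X_n^{(3)}$ be the number of non-empty boxes among the boxes $(n-j-1,j)$, $1\le j\le n-2$ (the third main diagonal). Then, as $n\to\infty$, $X_n^{(3)}$ converges in distribution to a Poisson random variable with parameter $1$.
   Context: A staircase tableau of size $n$ has boxes $(i,j)$ with $i,j\ge1$ and $i+j\le n+1$, rows numbered from the top and columns from the left. An $\alpha/\beta$-staircase tableau of size $n$ is a filling in which each box is empty or contains $\alpha$ or $\beta$, such that: all boxes in the same column and above an $\alpha$ are empty; all boxes in the same row and to the left of a $\beta$ are empty; every main-diagonal box (with $i+j=n+1$) contains a symbol. $\overline{\mathcal{S}}_n$ is the set of these. The weight is $wt(S)=\alpha^{N_\alpha}\beta^{N_\beta}$ ($N_\alpha,N_\beta$ the numbers of $\alpha$'s, $\beta$'s), and $\mathbb{P}_{n,\alpha,\beta}(S)=wt(S)/\sum_{T\in\overline{\mathcal{S}}_n}wt(T)$. *)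

theory Defs
  imports "HOL-Probability.Probability"
begin

datatype sym = Alpha | Beta

text \<open>A filling is a function (row i, column j) to an optional symbol (None = empty box).
  Rows and columns are numbered from 1.\<close>
type_synonym filling = "nat \<Rightarrow> nat \<Rightarrow> sym option"

definition in_stair :: "nat \<Rightarrow> nat \<Rightarrow> nat \<Rightarrow> bool" where
  "in_stair n i j \<longleftrightarrow> 1 \<le> i \<and> 1 \<le> j \<and> i + j \<le> n + 1"

definition is_ab_staircase :: "nat \<Rightarrow> filling \<Rightarrow> bool" where
  "is_ab_staircase n T \<longleftrightarrow>
     (\<forall>i j. \<not> in_stair n i j \<longrightarrow> T i j = None) \<and>
     (\<forall>i j. T i j = Some Alpha \<longrightarrow> (\<forall>i'. 1 \<le> i' \<and> i' < i \<longrightarrow> T i' j = None)) \<and>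
     (\<forall>i j. T i j = Some Beta \<longrightarrow> (\<forall>j'. 1 \<le> j' \<and> j' < j \<longrightarrow> T i j' = None)) \<and>
     (\<forall>i j. in_stair n i j \<and> i + j = n + 1 \<longrightarrow> T i j \<noteq> None)"

definition ab_staircases :: "nat \<Rightarrow> filling set" where
  "ab_staircases n = {T. is_ab_staircase n T}"

definition num_sym :: "nat \<Rightarrow> sym \<Rightarrow> filling \<Rightarrow> nat" where
  "num_sym n s T = card {(i, j). in_stair n i j \<and> T i j = Some s}"

definition wt :: "nat \<Rightarrow> real \<Rightarrow> real \<Rightarrow> filling \<Rightarrow> real" where
  "wt n \<alpha> \<beta> T = \<alpha> ^ num_sym n Alpha T * \<beta> ^ num_sym n Beta T"

definition Z :: "nat \<Rightarrow> real \<Rightarrow> real \<Rightarrow> real" where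
  "Z n \<alpha> \<beta> = (\<Sum>T\<in>ab_staircases n. wt n \<alpha> \<beta> T)"

definition stair_pmf :: "nat \<Rightarrow> real \<Rightarrow> real \<Rightarrow> filling pmf" where
  "stair_pmf n \<alpha> \<beta> = embed_pmf
     (\<lambda>T. if T \<in> ab_staircases n then wt n \<alpha> \<beta> T / Z n \<alpha> \<beta> else 0)"

definition X3 :: "nat \<Rightarrow> filling \<Rightarrow> nat" where
  "X3 n T = card {j \<in> {1..n - 2}. T (n - j - 1) j \<noteq> None}"

definition X3_law :: "nat \<Rightarrow> real \<Rightarrow> real \<Rightarrow> real measure" where
  "X3_law n \<alpha> \<beta> = measure_pmf (map_pmf (\<lambda>T. real (X3 n T)) (stair_pmf n \<alpha> \<beta>))"

end

theory Submission
  imports Defs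
begin

text \<open>
  Call a row free if it contains no \<open>\<beta>\<close>. Deleting the first column of a tableau leaves a tableau
  of size one less, and the deleted column can carry symbols only in its lowest box and in the
  free rows. Let \<open>F\<^sub>m(x; u, v)\<close> be the sum of \<open>wt(T) y^X3(T)\<close> over the tableaux of size \<open>m\<close>, with an
  extra factor \<open>x\<close> for every free row, except that the lowest row counts \<open>u\<close> and the last but one
  counts \<open>v\<close>; these two rows decide whether a column receives a symbol on the third diagonal.
  Summing over the deleted column gives a recurrence for \<open>F\<close>, from which \<open>u\<close> and \<open>v\<close> can be
  eliminated.

  For \<open>y = 1\<close> the recurrence is solved by a product. Dividing by it at \<open>x = 1 + k \<beta>\<close> yields, with
  \<open>\<eta> = y - 1\<close>, \<open>c = 1/\<alpha> + 1/\<beta>\<close> and \<open>M = c + s + k + 2\<close>,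
  \<open>g(s+3,k) = g(s+2,k+1) + \<eta>/M g(s,k+2) + (\<eta>\<^sup>2 g(s-1,k+2) + \<eta> g(s,k+1)) / (M (M-1))\<close>,
  where \<open>g(n,0)\<close> is the expectation of \<open>y^X3\<close>. The function \<open>exp (\<eta> s / (s+k))\<close> satisfies this up to
  \<open>O((s+k)\<^sup>-\<^sup>2)\<close>, so a discrete Gronwall argument gives \<open>g(n,0) \<longrightarrow> exp \<eta>\<close>, and for \<open>y = exp(it)\<close>
  Levy's continuity theorem applies.
\<close>

section \<open>Columns\<close>

definition columns_on :: "nat set \<Rightarrow> (nat \<rightharpoonup> sym) set" where
  "columns_on I = {c. dom c \<subseteq> I \<and> (\<forall>i i'. c i = Some Alpha \<longrightarrow> i' < i \<longrightarrow> c i' = None)}"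

definition full_columns :: "nat \<Rightarrow> nat set \<Rightarrow> (nat \<rightharpoonup> sym) set" where
  "full_columns k I = {c \<in> columns_on (insert k I). k \<in> dom c}"

lemma columns_onD:
  assumes "c \<in> columns_on I"
  shows "i \<notin> I \<Longrightarrow> c i = None" and "c i = Some Alpha \<Longrightarrow> i' < i \<Longrightarrow> c i' = None"
  using assms by (force simp: columns_on_def)+

lemma full_columnsD:
  assumes "c \<in> full_columns k I"
  shows "i \<notin> insert k I \<Longrightarrow> c i = None" and "c i = Some Alpha \<Longrightarrow> i' < i \<Longrightarrow> c i' = None"
    and "c k \<noteq> None"
proof -
  have c: "c \<in> columns_on (insert k I)" "k \<in> dom c"
    using assms by (simp_all add: full_columns_def)
  show "i \<notin> insert k I \<Longrightarrow> c i = None" "c i = Some Alpha \<Longrightarrow> i' < i \<Longrightarrow> c i' = None"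
    by (fact columns_onD[OF c(1)])+
  show "c k \<noteq> None" using c(2) by (rule domD[elim_format]) simp
qed

lemma columns_on_empty: "columns_on {} = {Map.empty}"
  by (auto simp: columns_on_def)

lemma columns_on_insert: "columns_on (insert k I) = columns_on I \<union> full_columns k I"
  by (auto simp: full_columns_def columns_on_def)

lemma columns_on_Int_full_columns:
  assumes "k \<notin> I"
  shows "columns_on I \<inter> full_columns k I = {}"
  using columns_onD(1)[OF _ assms] by (fastforce simp: full_columns_def)

lemma full_columns_eq:
  assumes I: "I \<subseteq> {..<k}"
  shows "full_columns k I = insert [k \<mapsto> Alpha] ((\<lambda>c. c(k \<mapsto> Beta)) ` columns_on I)"
proof (intro equalityI subsetI)
  fix c assume c: "c \<in> full_columns k I"
  note col = full_columnsD[OF c]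
  have outside: "c i = None" if "\<not> i \<le> k" for i
    using col(1)[of i] that I by force
  show "c \<in> insert [k \<mapsto> Alpha] ((\<lambda>c. c(k \<mapsto> Beta)) ` columns_on I)"
  proof (cases "c k = Some Alpha")
    case True
    have "c = [k \<mapsto> Alpha]"
    proof
      show "c i = [k \<mapsto> Alpha] i" for i
        using outside[of i] col(2)[OF True, of i] True by (cases i k rule: linorder_cases) auto
    qed
    then show ?thesis by simp
  next
    case False
    then have "c k = Some Beta" using col(3) by (metis not_None_eq sym.exhaust)
    then have "c = (c(k := None))(k \<mapsto> Beta)" by (simp add: fun_upd_idem)
    moreover have "c(k := None) \<in> columns_on I"
      using c by (auto simp: full_columns_def columns_on_def split: if_splits)
    ultimately show ?thesis by blast
  qed
next
  fix c assume "c \<in> insert [k \<mapsto> Alpha] ((\<lambda>c. c(k \<mapsto> Beta)) ` columns_on I)"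
  then consider (alpha) "c = [k \<mapsto> Alpha]"
    | (beta) c' where "c' \<in> columns_on I" "c = c'(k \<mapsto> Beta)" by blast
  then show "c \<in> full_columns k I"
  proof cases
    case alpha
    then show ?thesis by (auto simp: full_columns_def columns_on_def)
  next
    case beta
    have "\<not> k < i" if "c' i = Some Alpha" for i
      using columns_onD(1)[OF beta(1), of i] that I by force
    then show ?thesis
      using beta by (auto simp: full_columns_def columns_on_def split: if_splits)
  qed
qed

lemma finite_columns_on: "finite I \<Longrightarrow> finite (columns_on I)"
proof (induction I rule: finite_linorder_max_induct)
  case empty
  then show ?case by (simp add: columns_on_empty)
next
  case (insert k I)
  then have "I \<subseteq> {..<k}" by blast
  then show ?case using insert.IH by (simp add: columns_on_insert full_columns_eq)
qed

lemma finite_full_columns: "finite I \<Longrightarrow> finite (full_columns k I)"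
  using finite_columns_on[of "insert k I"] by (simp add: columns_on_insert)

lemma sum_full_columns:
  fixes f :: "nat \<Rightarrow> sym option \<Rightarrow> 'a::comm_semiring_1"
  assumes I: "I \<subseteq> {..<k}"
  shows "(\<Sum>c\<in>full_columns k I. \<Prod>i\<in>insert k I. f i (c i)) =
    f k (Some Alpha) * (\<Prod>i\<in>I. f i None) +
    f k (Some Beta) * (\<Sum>c\<in>columns_on I. \<Prod>i\<in>I. f i (c i))"
proof -
  have fin: "finite I" and k: "k \<notin> I" using I finite_subset by auto
  have inj: "inj_on (\<lambda>c. c(k \<mapsto> Beta)) (columns_on I)"
    using columns_onD(1)[OF _ k] by (intro inj_onI) (metis fun_upd_triv fun_upd_upd)
  have not_beta: "[k \<mapsto> Alpha] \<notin> (\<lambda>c. c(k \<mapsto> Beta)) ` columns_on I"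
    by (auto dest: fun_cong[of _ _ k])
  have prod_upd: "(\<Prod>i\<in>insert k I. f i ((c(k := s)) i)) = f k s * (\<Prod>i\<in>I. f i (c i))" for c s
  proof -
    have "(\<Prod>i\<in>I. f i ((c(k := s)) i)) = (\<Prod>i\<in>I. f i (c i))"
      using k by (intro prod.cong) auto
    then show ?thesis using fin k by simp
  qed
  show ?thesis
    unfolding full_columns_eq[OF I]
      sum.insert[OF finite_imageI[OF finite_columns_on[OF fin]] not_beta]
      sum.reindex[OF inj] o_def prod_upd sum_distrib_left ..
qed

lemma sum_columns_on_insert:
  fixes f :: "nat \<Rightarrow> sym option \<Rightarrow> 'a::comm_semiring_1"
  assumes I: "I \<subseteq> {..<k}"
  shows "(\<Sum>c\<in>columns_on (insert k I). \<Prod>i\<in>insert k I. f i (c i)) =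
    (f k None + f k (Some Beta)) * (\<Sum>c\<in>columns_on I. \<Prod>i\<in>I. f i (c i)) +
    f k (Some Alpha) * (\<Prod>i\<in>I. f i None)"
proof -
  have fin: "finite I" and k: "k \<notin> I" using I finite_subset by auto
  have "(\<Sum>c\<in>columns_on (insert k I). \<Prod>i\<in>insert k I. f i (c i)) =
    (\<Sum>c\<in>columns_on I. \<Prod>i\<in>insert k I. f i (c i)) +
    (\<Sum>c\<in>full_columns k I. \<Prod>i\<in>insert k I. f i (c i))"
    unfolding columns_on_insert
    by (intro sum.union_disjoint finite_columns_on finite_full_columns
        columns_on_Int_full_columns fin k)
  also have "(\<Sum>c\<in>columns_on I. \<Prod>i\<in>insert k I. f i (c i)) =
    f k None * (\<Sum>c\<in>columns_on I. \<Prod>i\<in>I. f i (c i))"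
    unfolding sum_distrib_left using fin k by (intro sum.cong refl) (simp add: columns_onD(1))
  finally show ?thesis
    unfolding sum_full_columns[OF I] by (simp add: algebra_simps)
qed

text \<open>Here \<open>z\<close> marks the symbols on the third diagonal, and \<open>w\<close> is the factor of the row of the box,
  due as long as the row stays free.\<close>

definition box_weight :: "'a::comm_semiring_1 \<Rightarrow> 'a \<Rightarrow> 'a \<Rightarrow> 'a \<Rightarrow> sym option \<Rightarrow> 'a" where
  "box_weight a b z w s =
     (case s of None \<Rightarrow> w | Some Alpha \<Rightarrow> a * z * w | Some Beta \<Rightarrow> b * z)"

lemma box_weight_simps [simp]:
  "box_weight a b z w None = w"
  "box_weight a b z w (Some Alpha) = a * z * w"
  "box_weight a b z w (Some Beta) = b * z"
  by (simp_all add: box_weight_def)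

definition column_weight ::
    "'a::comm_semiring_1 \<Rightarrow> 'a \<Rightarrow> (nat \<Rightarrow> 'a) \<Rightarrow> (nat \<Rightarrow> 'a) \<Rightarrow> nat set \<Rightarrow> (nat \<rightharpoonup> sym) \<Rightarrow> 'a" where
  "column_weight a b z w I c = (\<Prod>i\<in>I. box_weight a b (z i) (w i) (c i))"

lemma column_weight_eq:
  assumes "finite I"
  shows "column_weight a b z w I c =
    a ^ card {i \<in> I. c i = Some Alpha} * b ^ card {i \<in> I. c i = Some Beta} *
    (\<Prod>i\<in>{i \<in> I. c i \<noteq> None}. z i) * (\<Prod>i\<in>{i \<in> I. c i \<noteq> Some Beta}. w i)"
proof -
  have split: "box_weight a b (z i) (w i) (c i) =
    (if c i = Some Alpha then a else 1) * (if c i = Some Beta then b else 1) *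
    (if c i \<noteq> None then z i else 1) * (if c i \<noteq> Some Beta then w i else 1)" for i
    by (auto simp: box_weight_def split: option.split sym.split)
  show ?thesis
    using assms unfolding column_weight_def split prod.distrib
    by (simp add: prod.inter_filter[symmetric])
qed

lemma sum_columns_on_weight:
  fixes a b x :: "'a::comm_ring_1"
  assumes "finite I" and w: "\<And>i. i \<in> I \<Longrightarrow> w i = x"
  shows "b * (\<Sum>c\<in>columns_on I. column_weight a b z w I c) =
    (a * x + b) * (\<Prod>i\<in>I. x + b * z i) - a * x * x ^ card I"
  using assms
proof (induction I rule: finite_linorder_max_induct)
  case empty
  then show ?case by (simp add: columns_on_empty column_weight_def)
next
  case (insert k I)
  then have I: "I \<subseteq> {..<k}" and k: "k \<notin> I" and wk: "w k = x" and wI: "(\<Prod>i\<in>I. w i) = x ^ card I"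
    by auto
  have "b * (\<Sum>c\<in>columns_on (insert k I). column_weight a b z w (insert k I) c) =
    (x + b * z k) * (b * (\<Sum>c\<in>columns_on I. column_weight a b z w I c)) +
    a * b * z k * x * x ^ card I"
    unfolding column_weight_def sum_columns_on_insert[OF I, of "\<lambda>i. box_weight a b (z i) (w i)"]
    by (simp add: wk wI algebra_simps)
  also have "b * (\<Sum>c\<in>columns_on I. column_weight a b z w I c) =
    (a * x + b) * (\<Prod>i\<in>I. x + b * z i) - a * x * x ^ card I"
    using insert.IH insert.prems by blast
  also have "(x + b * z k) * \<dots> + a * b * z k * x * x ^ card I =
    (a * x + b) * (\<Prod>i\<in>insert k I. x + b * z i) - a * x * x ^ card (insert k I)"
    using insert.hyps(1) k by (simp add: algebra_simps)
  finally show ?case .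
qed

lemma sum_full_columns_weight:
  fixes a b x :: "'a::comm_ring_1"
  assumes I: "I \<subseteq> {..<k}" and w: "\<And>i. i \<in> I \<Longrightarrow> w i = x"
  shows "(\<Sum>c\<in>full_columns k I. column_weight a b z w (insert k I) c) =
    z k * ((a * x + b) * (\<Prod>i\<in>I. x + b * z i) + a * (w k - x) * x ^ card I)"
proof -
  have "finite I" using I finite_subset by blast
  have "(\<Sum>c\<in>full_columns k I. column_weight a b z w (insert k I) c) =
    z k * (a * w k * x ^ card I + b * (\<Sum>c\<in>columns_on I. column_weight a b z w I c))"
    unfolding column_weight_def sum_full_columns[OF I, of "\<lambda>i. box_weight a b (z i) (w i)"]
    using w by (simp add: algebra_simps)
  also have "b * (\<Sum>c\<in>columns_on I. column_weight a b z w I c) =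
    (a * x + b) * (\<Prod>i\<in>I. x + b * z i) - a * x * x ^ card I"
    by (rule sum_columns_on_weight[OF \<open>finite I\<close> w])
  finally show ?thesis by (simp add: algebra_simps)
qed

lemma sum_full_columns_insert_weight:
  fixes a b x :: "'a::comm_ring_1"
  assumes I: "I \<subseteq> {..<l}" and l: "l < k" and w: "\<And>i. i \<in> I \<Longrightarrow> w i = x"
  shows "(\<Sum>c\<in>full_columns k (insert l I). column_weight a b z w (insert k (insert l I)) c) =
    z k * ((a * x + b) * (w l + b * z l) * (\<Prod>i\<in>I. x + b * z i) +
      (a * (w k - x) * w l + a * b * z l * (w l - x)) * x ^ card I)"
proof -
  let ?f = "\<lambda>i. box_weight a b (z i) (w i)" and ?S = "\<Sum>c\<in>columns_on I. column_weight a b z w I c"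
  have fin: "finite I" and lI: "l \<notin> I" using I finite_subset by auto
  have less: "insert l I \<subseteq> {..<k}" using I l by auto
  have "(\<Sum>c\<in>full_columns k (insert l I). column_weight a b z w (insert k (insert l I)) c) =
    z k * (a * w k * w l * (\<Prod>i\<in>I. w i) + (w l + b * z l) * (b * ?S) +
      a * b * z l * w l * (\<Prod>i\<in>I. w i))"
    unfolding column_weight_def sum_full_columns[OF less, of ?f] sum_columns_on_insert[OF I, of ?f]
    using fin lI by (simp add: algebra_simps)
  also have "b * ?S = (a * x + b) * (\<Prod>i\<in>I. x + b * z i) - a * x * x ^ card I"
    by (rule sum_columns_on_weight[OF fin w])
  finally show ?thesis using w by (simp add: algebra_simps)
qed

section \<open>Removing the first column of a tableau\<close>

definition free_rows :: "nat \<Rightarrow> filling \<Rightarrow> nat set" where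
  "free_rows m T = {i \<in> {1..m}. \<forall>j. T i j \<noteq> Some Beta}"

definition cons_col :: "(nat \<rightharpoonup> sym) \<Rightarrow> filling \<Rightarrow> filling" where
  "cons_col c T = (\<lambda>i j. if j = 0 then None else if j = 1 then c i else T i (j - 1))"

definition drop_col :: "filling \<Rightarrow> filling" where
  "drop_col T = (\<lambda>i j. if j = 0 then None else T i (Suc j))"

lemma cons_col_simps [simp]:
  "cons_col c T i 0 = None" "cons_col c T i (Suc 0) = c i" "0 < j \<Longrightarrow> cons_col c T i (Suc j) = T i j"
  by (simp_all add: cons_col_def)

lemma free_rows_subset: "free_rows m T \<subseteq> {1..m}"
  by (auto simp: free_rows_def)

lemma finite_free_rows [simp]: "finite (free_rows m T)"
  by (simp add: free_rows_def)

lemma ab_staircasesI: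
  assumes "\<And>i j. \<not> in_stair n i j \<Longrightarrow> T i j = None"
    and "\<And>i j i'. T i j = Some Alpha \<Longrightarrow> 1 \<le> i' \<Longrightarrow> i' < i \<Longrightarrow> T i' j = None"
    and "\<And>i j j'. T i j = Some Beta \<Longrightarrow> 1 \<le> j' \<Longrightarrow> j' < j \<Longrightarrow> T i j' = None"
    and "\<And>i j. in_stair n i j \<Longrightarrow> i + j = n + 1 \<Longrightarrow> T i j \<noteq> None"
  shows "T \<in> ab_staircases n"
  using assms unfolding ab_staircases_def is_ab_staircase_def by blast

lemma ab_staircasesD:
  assumes "T \<in> ab_staircases n"
  shows "\<not> in_stair n i j \<Longrightarrow> T i j = None"
    and "T i j = Some Alpha \<Longrightarrow> 1 \<le> i' \<Longrightarrow> i' < i \<Longrightarrow> T i' j = None"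
    and "T i j = Some Beta \<Longrightarrow> 1 \<le> j' \<Longrightarrow> j' < j \<Longrightarrow> T i j' = None"
    and "in_stair n i j \<Longrightarrow> i + j = n + 1 \<Longrightarrow> T i j \<noteq> None"
  using assms unfolding ab_staircases_def is_ab_staircase_def by blast+

lemma cons_col_in_ab_staircases:
  assumes T: "T \<in> ab_staircases m" and c: "c \<in> full_columns (Suc m) (free_rows m T)"
  shows "cons_col c T \<in> ab_staircases (Suc m)"
proof (rule ab_staircasesI)
  fix i j
  note TD = ab_staircasesD[OF T] and cD = full_columnsD[OF c]
  show "cons_col c T i j = None" if out: "\<not> in_stair (Suc m) i j"
  proof (cases "j = 1")
    case True
    then show ?thesis
      using out cD(1)[of i] free_rows_subset[of m T] by (force simp: in_stair_def)
  next
    case False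
    then show ?thesis
      using out by (auto simp: cons_col_def in_stair_def intro!: TD(1))
  qed
  show "cons_col c T i' j = None" if "cons_col c T i j = Some Alpha" "1 \<le> i'" "i' < i" for i'
    using that cD(2)[of i i'] TD(2)[of i "j - 1" i'] by (auto simp: cons_col_def split: if_splits)
  show "cons_col c T i j' = None"
    if beta: "cons_col c T i j = Some Beta" and j': "1 \<le> j'" "j' < j" for j'
  proof (cases "j' = 1")
    case True
    have "T i (j - 1) = Some Beta" using beta j' by (auto simp: cons_col_def split: if_splits)
    moreover from this have "in_stair m i (j - 1)" using TD(1) by force
    ultimately have "i \<notin> insert (Suc m) (free_rows m T)"
      by (auto simp: free_rows_def in_stair_def)
    then show ?thesis using True cD(1) by simp
  next
    case False
    then show ?thesis
      using beta j' TD(3)[of i "j - 1" "j' - 1"] by (auto simp: cons_col_def split: if_splits)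
  qed
  show "cons_col c T i j \<noteq> None" if "in_stair (Suc m) i j" "i + j = Suc m + 1"
    using that TD(4)[of i "j - 1"] cD(3) by (cases "j = 1") (auto simp: cons_col_def in_stair_def)
qed

lemma drop_col_in_ab_staircases:
  assumes T: "T \<in> ab_staircases (Suc m)"
  shows "drop_col T \<in> ab_staircases m"
proof (rule ab_staircasesI)
  fix i j
  note TD = ab_staircasesD[OF T]
  show "drop_col T i j = None" if "\<not> in_stair m i j"
    using that TD(1)[of i "Suc j"] by (auto simp: drop_col_def in_stair_def)
  show "drop_col T i' j = None" if "drop_col T i j = Some Alpha" "1 \<le> i'" "i' < i" for i'
    using that TD(2)[of i "Suc j" i'] by (auto simp: drop_col_def split: if_splits)
  show "drop_col T i j' = None" if "drop_col T i j = Some Beta" "1 \<le> j'" "j' < j" for j'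
    using that TD(3)[of i "Suc j" "Suc j'"] by (auto simp: drop_col_def split: if_splits)
  show "drop_col T i j \<noteq> None" if "in_stair m i j" "i + j = m + 1"
    using that TD(4)[of i "Suc j"] by (auto simp: drop_col_def in_stair_def)
qed

lemma first_column_in_full_columns:
  assumes T: "T \<in> ab_staircases (Suc m)"
  shows "(\<lambda>i. T i 1) \<in> full_columns (Suc m) (free_rows m (drop_col T))"
proof -
  note TD = ab_staircasesD[OF T]
  have "i \<in> insert (Suc m) (free_rows m (drop_col T))" if "T i 1 \<noteq> None" for i
  proof -
    have "drop_col T i j \<noteq> Some Beta" for j
      using that TD(3)[of i "Suc j" 1] by (auto simp: drop_col_def)
    moreover have "1 \<le> i \<and> i \<le> Suc m"
      using that TD(1)[of i 1] by (force simp: in_stair_def)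
    ultimately show ?thesis by (auto simp: free_rows_def)
  qed
  moreover have "T i' 1 = None" if "T i 1 = Some Alpha" "i' < i" for i i'
    using that TD(1)[of i' 1] TD(2)[of i 1 i'] by (cases "i' = 0") (auto simp: in_stair_def)
  moreover have "T (Suc m) 1 \<noteq> None"
    using TD(4)[of "Suc m" 1] by (simp add: in_stair_def)
  ultimately show ?thesis
    unfolding full_columns_def columns_on_def by blast
qed

lemma bij_betw_cons_col:
  "bij_betw (\<lambda>(T, c). cons_col c T)
    (SIGMA T:ab_staircases m. full_columns (Suc m) (free_rows m T)) (ab_staircases (Suc m))"
proof (rule bij_betw_byWitness[where f' = "\<lambda>T. (drop_col T, \<lambda>i. T i 1)"])
  have "drop_col (cons_col c T) = T" if "T \<in> ab_staircases m" for T c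
    using ab_staircasesD(1)[OF that] by (auto simp: fun_eq_iff drop_col_def in_stair_def)
  then show "\<forall>p\<in>SIGMA T:ab_staircases m. full_columns (Suc m) (free_rows m T).
      (\<lambda>T. (drop_col T, \<lambda>i. T i 1)) ((\<lambda>(T, c). cons_col c T) p) = p"
    by auto
  have "cons_col (\<lambda>i. T i 1) (drop_col T) = T" if "T \<in> ab_staircases (Suc m)" for T
    using ab_staircasesD(1)[OF that]
    by (auto simp: fun_eq_iff cons_col_def drop_col_def in_stair_def)
  then show "\<forall>T\<in>ab_staircases (Suc m). (\<lambda>(T, c). cons_col c T) (drop_col T, \<lambda>i. T i 1) = T"
    by simp
qed (auto intro: cons_col_in_ab_staircases drop_col_in_ab_staircases
    first_column_in_full_columns[unfolded One_nat_def])

lemma ab_staircases_0: "ab_staircases 0 = {\<lambda>_ _. None}"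
  by (auto simp: ab_staircases_def is_ab_staircase_def in_stair_def fun_eq_iff)

lemma finite_ab_staircases [simp]: "finite (ab_staircases n)"
proof (induction n)
  case (Suc n)
  then show ?case
    by (subst bij_betw_finite[OF bij_betw_cons_col, symmetric]) (simp add: finite_full_columns)
qed (simp add: ab_staircases_0)

lemma num_sym_cons_col:
  assumes c: "c \<in> full_columns (Suc m) (free_rows m T)"
  shows "num_sym (Suc m) s (cons_col c T) = num_sym m s T +
    card {i \<in> insert (Suc m) (free_rows m T). c i = Some s}"
proof -
  let ?A = "{(i, j). in_stair m i j \<and> T i j = Some s}"
  let ?B = "{i \<in> insert (Suc m) (free_rows m T). c i = Some s}"
  have row: "c i = Some s \<longleftrightarrow> i \<in> ?B" for i
    using full_columnsD(1)[OF c, of i] by force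
  have "(i, j) \<in> {(i, j). in_stair (Suc m) i j \<and> cons_col c T i j = Some s} \<longleftrightarrow>
    (i, j) \<in> map_prod id Suc ` ?A \<union> (\<lambda>i. (i, 1)) ` ?B" for i j
  proof (cases "j = 1")
    case True
    then show ?thesis
      using row[of i] free_rows_subset[of m T] by (auto simp: in_stair_def)
  next
    case False
    then show ?thesis
      by (cases j) (force simp: in_stair_def)+
  qed
  then have "{(i, j). in_stair (Suc m) i j \<and> cons_col c T i j = Some s} =
    map_prod id Suc ` ?A \<union> (\<lambda>i. (i, 1)) ` ?B" by auto
  moreover have "finite ?A"
    by (rule finite_subset[of _ "{..m} \<times> {..m}"]) (auto simp: in_stair_def)
  moreover have "map_prod id Suc ` ?A \<inter> (\<lambda>i. (i, 1)) ` ?B = {}"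
    by (auto simp: in_stair_def)
  ultimately show ?thesis
    unfolding num_sym_def
    by (simp add: card_Un_disjoint card_image inj_on_def del: One_nat_def)
qed

lemma X3_cons_col:
  assumes c: "c \<in> full_columns (Suc m) (free_rows m T)"
  shows "X3 (Suc m) (cons_col c T) = X3 m T + (if c (m - 1) \<noteq> None then 1 else 0)"
proof -
  let ?A = "{j \<in> {1..m - 2}. T (m - j - 1) j \<noteq> None}"
  let ?B = "if c (m - 1) \<noteq> None then {1} else {}"
  have c0: "c 0 = None"
    using full_columnsD(1)[OF c, of 0] by (simp add: free_rows_def)
  have "j \<in> {j \<in> {1..Suc m - 2}. cons_col c T (Suc m - j - 1) j \<noteq> None} \<longleftrightarrow> j \<in> Suc ` ?A \<union> ?B" for j
  proof (cases "j = 1")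
    case True
    then show ?thesis using c0 by (cases "m < 2") auto
  next
    case False
    then show ?thesis by (cases j) auto
  qed
  then have "{j \<in> {1..Suc m - 2}. cons_col c T (Suc m - j - 1) j \<noteq> None} = Suc ` ?A \<union> ?B" by blast
  moreover have "Suc ` ?A \<inter> {1} = {}" by auto
  ultimately show ?thesis
    unfolding X3_def by (auto simp: card_Un_disjoint card_image)
qed

lemma free_rows_cons_col:
  assumes T: "T \<in> ab_staircases m"
  shows "free_rows (Suc m) (cons_col c T) = {i \<in> insert (Suc m) (free_rows m T). c i \<noteq> Some Beta}"
proof -
  have beta_free: "(\<forall>j. cons_col c T i j \<noteq> Some Beta) \<longleftrightarrow>
    c i \<noteq> Some Beta \<and> (\<forall>j. T i j \<noteq> Some Beta)" for i
  proof
    assume no_beta: "\<forall>j. cons_col c T i j \<noteq> Some Beta"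
    have "T i j \<noteq> Some Beta" for j
      using no_beta[rule_format, of "Suc j"] ab_staircasesD(1)[OF T, of i 0]
      by (cases "j = 0") (auto simp: in_stair_def)
    then show "c i \<noteq> Some Beta \<and> (\<forall>j. T i j \<noteq> Some Beta)"
      using no_beta[rule_format, of 1] by simp
  qed (auto simp: cons_col_def)
  have "T (Suc m) j = None" for j
    using ab_staircasesD(1)[OF T] by (simp add: in_stair_def)
  then show ?thesis
    unfolding free_rows_def beta_free by (auto simp: le_Suc_eq)
qed

section \<open>Generating functions\<close>

definition stair_weight :: "'a::comm_semiring_1 \<Rightarrow> 'a \<Rightarrow> 'a \<Rightarrow> nat \<Rightarrow> filling \<Rightarrow> 'a" where
  "stair_weight a b y m T = a ^ num_sym m Alpha T * b ^ num_sym m Beta T * y ^ X3 m T"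

definition diag3_mark :: "'a::comm_semiring_1 \<Rightarrow> nat \<Rightarrow> nat \<Rightarrow> 'a" where
  "diag3_mark y m i = (if Suc i = m then y else 1)"

definition stair_gf :: "'a::comm_semiring_1 \<Rightarrow> 'a \<Rightarrow> 'a \<Rightarrow> nat \<Rightarrow> (nat \<Rightarrow> 'a) \<Rightarrow> 'a" where
  "stair_gf a b y m w = (\<Sum>T\<in>ab_staircases m. stair_weight a b y m T * (\<Prod>i\<in>free_rows m T. w i))"

lemma prod_diag3_mark:
  assumes c: "c \<in> full_columns (Suc m) (free_rows m T)"
  shows "(\<Prod>i\<in>{i \<in> insert (Suc m) (free_rows m T). c i \<noteq> None}. diag3_mark y m i) =
    y ^ (if c (m - 1) \<noteq> None then 1 else 0)"
proof -
  let ?I = "{i \<in> insert (Suc m) (free_rows m T). c i \<noteq> None}"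
  have "(\<Prod>i\<in>?I. diag3_mark y m i) = (\<Prod>i\<in>?I \<inter> {i. Suc i = m}. y)"
    unfolding diag3_mark_def by (subst prod.If_cases) auto
  also have "?I \<inter> {i. Suc i = m} = (if c (m - 1) \<noteq> None then {m - 1} else {})"
    using full_columnsD(1)[OF c, of "m - 1"] full_columnsD(1)[OF c, of 0] free_rows_subset[of m T]
    by (cases m) auto
  finally show ?thesis by simp
qed

lemma stair_weight_cons_col:
  assumes T: "T \<in> ab_staircases m" and c: "c \<in> full_columns (Suc m) (free_rows m T)"
  shows "stair_weight a b y (Suc m) (cons_col c T) *
      (\<Prod>i\<in>free_rows (Suc m) (cons_col c T). w i) =
    stair_weight a b y m T *
      column_weight a b (diag3_mark y m) w (insert (Suc m) (free_rows m T)) c"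
  unfolding stair_weight_def num_sym_cons_col[OF c] X3_cons_col[OF c] free_rows_cons_col[OF T]
    column_weight_eq[OF finite.insertI[OF finite_free_rows]] prod_diag3_mark[OF c] power_add
  by (simp only: mult_ac)

lemma stair_gf_Suc:
  "stair_gf a b y (Suc m) w = (\<Sum>T\<in>ab_staircases m. stair_weight a b y m T *
    (\<Sum>c\<in>full_columns (Suc m) (free_rows m T).
      column_weight a b (diag3_mark y m) w (insert (Suc m) (free_rows m T)) c))"
proof -
  have "stair_gf a b y (Suc m) w =
    (\<Sum>(T, c)\<in>(SIGMA T:ab_staircases m. full_columns (Suc m) (free_rows m T)).
      stair_weight a b y m T *
      column_weight a b (diag3_mark y m) w (insert (Suc m) (free_rows m T)) c)"
    unfolding stair_gf_def sum.reindex_bij_betw[OF bij_betw_cons_col, symmetric]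
    by (intro sum.cong refl) (auto simp: stair_weight_cons_col)
  then show ?thesis
    by (simp add: sum.Sigma[symmetric] finite_full_columns sum_distrib_left)
qed

lemma stair_gf_0: "stair_gf a b y 0 w = 1"
  by (simp add: stair_gf_def stair_weight_def ab_staircases_0 num_sym_def X3_def free_rows_def)

definition row_weight :: "nat \<Rightarrow> 'a \<Rightarrow> 'a \<Rightarrow> 'a \<Rightarrow> nat \<Rightarrow> 'a" where
  "row_weight m x u v i = (if i = m then u else if Suc i = m then v else x)"

definition bottom_gf :: "'a::comm_semiring_1 \<Rightarrow> 'a \<Rightarrow> 'a \<Rightarrow> nat \<Rightarrow> 'a \<Rightarrow> 'a \<Rightarrow> 'a \<Rightarrow> 'a" where
  "bottom_gf a b y m x u v = stair_gf a b y m (row_weight m x u v)"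

definition diag_gf :: "'a::comm_semiring_1 \<Rightarrow> 'a \<Rightarrow> 'a \<Rightarrow> nat \<Rightarrow> 'a \<Rightarrow> 'a" where
  "diag_gf a b y m x = stair_gf a b y m (\<lambda>_. x)"

lemma bottom_gf_same: "bottom_gf a b y m x x x = diag_gf a b y m x"
proof -
  have "row_weight m x x x = (\<lambda>_. x)" by (auto simp: row_weight_def)
  then show ?thesis by (simp add: bottom_gf_def diag_gf_def)
qed

lemma prod_row_weight:
  fixes x y b u :: "'a::comm_semiring_1"
  assumes "m \<notin> J"
  shows "(\<Prod>i\<in>J. row_weight m x u x i) = x ^ card J"
    and "(\<Prod>i\<in>J. row_weight m (x + b) u (x + b * y) i) = (\<Prod>i\<in>J. x + b * diag3_mark y m i)"
proof -
  have "row_weight m x u x i = x" if "i \<in> J" for i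
    using assms that by (auto simp: row_weight_def)
  then show "(\<Prod>i\<in>J. row_weight m x u x i) = x ^ card J"
    unfolding prod_constant[symmetric] by (intro prod.cong refl)
  show "(\<Prod>i\<in>J. row_weight m (x + b) u (x + b * y) i) = (\<Prod>i\<in>J. x + b * diag3_mark y m i)"
    using assms by (intro prod.cong refl) (auto simp: row_weight_def diag3_mark_def)
qed

text \<open>The difference of the last two products is \<open>x ^ card (I - {m})\<close> if \<open>m \<in> I\<close> and 0 otherwise;
  as a difference of products it sums to generating functions.\<close>

lemma sum_full_columns_row_weight:
  fixes a b x :: "'a::comm_ring_1"
  assumes I: "I \<subseteq> {1..m}"
  shows "(\<Sum>c\<in>full_columns (Suc m) I.
      column_weight a b (diag3_mark y m) (row_weight (Suc m) x u v) (insert (Suc m) I) c) =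
    (a * x + b) * (\<Prod>i\<in>I. row_weight m (x + b) (v + b) (x + b * y) i) +
    a * (u - x) * (\<Prod>i\<in>I. row_weight m x v x i) +
    a * b * (v - x) * ((\<Prod>i\<in>I. row_weight m x 1 x i) - (\<Prod>i\<in>I. row_weight m x 0 x i))"
proof -
  define J where "J = I - {m}"
  have mJ: "m \<notin> J" and J: "J \<subseteq> {..<m}"
    using I by (force simp: J_def)+
  then have fin: "finite J" using finite_subset by blast
  have w: "row_weight (Suc m) x u v i = x" if "i \<in> J" for i
    using that J by (auto simp: row_weight_def)
  have bottom: "row_weight (Suc m) x u v (Suc m) = u" "row_weight (Suc m) x u v m = v"
    "diag3_mark y m (Suc m) = 1" "diag3_mark y m m = 1"
    by (simp_all add: row_weight_def diag3_mark_def)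
  show ?thesis
  proof (cases "m \<in> I")
    case True
    then have I_eq: "I = insert m J" by (auto simp: J_def)
    have prod_I: "(\<Prod>i\<in>I. row_weight m s t r i) = t * (\<Prod>i\<in>J. row_weight m s t r i)"
      for s t r :: 'a
      unfolding I_eq using fin mJ by (simp add: row_weight_def)
    show ?thesis
      unfolding prod_I prod_row_weight[OF mJ] unfolding I_eq
      by (subst sum_full_columns_insert_weight[where x = x, OF J lessI])
        (simp_all add: w bottom algebra_simps)
  next
    case False
    then have I_eq: "I = J" by (auto simp: J_def)
    have less: "J \<subseteq> {..<Suc m}" using J by auto
    show ?thesis
      unfolding I_eq prod_row_weight[OF mJ]
      by (subst sum_full_columns_weight[where x = x, OF less])
        (simp_all add: w bottom algebra_simps)
  qed
qed

lemma bottom_gf_Suc: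
  fixes a b x :: "'a::comm_ring_1"
  shows "bottom_gf a b y (Suc m) x u v =
    (a * x + b) * bottom_gf a b y m (x + b) (v + b) (x + b * y) +
    a * (u - x) * bottom_gf a b y m x v x +
    a * b * (v - x) * (bottom_gf a b y m x 1 x - bottom_gf a b y m x 0 x)"
  unfolding bottom_gf_def stair_gf_Suc sum_full_columns_row_weight[OF free_rows_subset]
  unfolding stair_gf_def
  by (simp add: algebra_simps sum.distrib sum_subtractf sum_distrib_left)

lemma bottom_gf_Suc_affine:
  fixes a b x :: "'a::comm_ring_1"
  shows "bottom_gf a b y (Suc m) x u v =
    bottom_gf a b y (Suc m) x u' v + a * (u - u') * bottom_gf a b y m x v x"
  by (simp add: bottom_gf_Suc algebra_simps)

lemma bottom_gf_raise_last:
  fixes a b x :: "'a::comm_ring_1"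
  shows "bottom_gf a b y m x u x =
    diag_gf a b y m x + (if m = 0 then 0 else a * (u - x) * diag_gf a b y (m - 1) x)"
proof (cases m)
  case 0
  then show ?thesis by (simp add: bottom_gf_def diag_gf_def stair_gf_0)
next
  case (Suc l)
  then show ?thesis
    using bottom_gf_Suc_affine[of a b y l x u x x] by (simp add: bottom_gf_same)
qed

lemma bottom_gf_Suc_Suc:
  fixes a b x :: "'a::comm_ring_1"
  shows "bottom_gf a b y (Suc (Suc m)) x u v =
    (a * x + b) * bottom_gf a b y (Suc m) (x + b) (v + b) (x + b * y) +
    a * (u - x) * bottom_gf a b y (Suc m) x v x +
    a\<^sup>2 * b * (v - x) * diag_gf a b y m x"
  unfolding bottom_gf_Suc[of a b y "Suc m"] bottom_gf_Suc_affine[of a b y m x 1 x 0] bottom_gf_same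
  by (simp add: algebra_simps power2_eq_square)

lemma diag_gf_Suc:
  fixes a b x :: "'a::comm_ring_1"
  shows "diag_gf a b y (Suc m) x = (a * x + b) * bottom_gf a b y m (x + b) (x + b) (x + b * y)"
  unfolding bottom_gf_same[symmetric] bottom_gf_Suc by (simp add: algebra_simps)

lemma diag_gf_one:
  fixes a b x :: "'a::comm_ring_1"
  shows "diag_gf a b 1 m x = (\<Prod>i<m. a * (x + of_nat i * b) + b)"
proof (induction m arbitrary: x)
  case 0
  then show ?case by (simp add: diag_gf_def stair_gf_0)
next
  case (Suc m)
  have "diag_gf a b 1 (Suc m) x = (a * x + b) * diag_gf a b 1 m (x + b)"
    unfolding diag_gf_Suc by (simp add: bottom_gf_same)
  also have "\<dots> = (\<Prod>i<Suc m. a * (x + of_nat i * b) + b)"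
    unfolding Suc.IH prod.lessThan_Suc_shift by (simp add: algebra_simps)
  finally show ?case .
qed

lemma diag_gf_small:
  assumes "m \<le> 2"
  shows "diag_gf a b y m x = diag_gf a b 1 m x"
  using assms by (simp add: diag_gf_def stair_gf_def stair_weight_def X3_def)

text \<open>The weights of the two lowest rows are moved back to \<open>x\<close> one after the other.\<close>

lemma diag_gf_add_3:
  fixes a b x y :: "'a::comm_ring_1"
  defines "e \<equiv> (y - 1) * b"
  shows "diag_gf a b y (m + 3) x = (a * x + b) * (diag_gf a b y (m + 2) (x + b) +
    (a * (x + b) + b) * (a * e) * (diag_gf a b y m (x + 2 * b) +
      (if m = 0 then 0 else a * e * diag_gf a b y (m - 1) (x + 2 * b))) +
    a\<^sup>2 * b * e * diag_gf a b y m (x + b))"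
proof -
  let ?F = "bottom_gf a b y" and ?A = "diag_gf a b y"
  let ?x1 = "x + b" and ?x2 = "x + 2 * b"
  have x2: "?x1 + b = ?x2" by simp
  have y: "z + b * y = z + b + e" for z by (simp add: e_def algebra_simps)
  have "?A (m + 3) x = (a * x + b) * ?F (Suc (Suc m)) ?x1 ?x1 (?x1 + e)"
    using diag_gf_Suc[of a b y "Suc (Suc m)" x] by (simp add: y eval_nat_numeral)
  also have "?F (Suc (Suc m)) ?x1 ?x1 (?x1 + e) =
    (a * ?x1 + b) * ?F (Suc m) ?x2 (?x2 + e) (?x2 + e) + a\<^sup>2 * b * e * ?A m ?x1"
    unfolding bottom_gf_Suc_Suc y by (simp add: algebra_simps)
  also have "?F (Suc m) ?x2 (?x2 + e) (?x2 + e) =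
    ?F (Suc m) ?x2 ?x2 (?x2 + e) + a * e * ?F m ?x2 (?x2 + e) ?x2"
    by (subst bottom_gf_Suc_affine[where u' = ?x2]) simp
  also have "?F m ?x2 (?x2 + e) ?x2 = ?A m ?x2 + (if m = 0 then 0 else a * e * ?A (m - 1) ?x2)"
    unfolding bottom_gf_raise_last by simp
  also have "(a * ?x1 + b) * (?F (Suc m) ?x2 ?x2 (?x2 + e) + a * e * t) =
    ?A (m + 2) ?x1 + (a * ?x1 + b) * (a * e) * t" for t
    using diag_gf_Suc[of a b y "Suc m" ?x1]
    by (simp only: y x2 distrib_left mult.assoc add_2_eq_Suc')
  finally show ?thesis .
qed

text \<open>At \<open>x = 1\<close> this is the probability generating function of \<^const>\<open>X3\<close>.\<close>

definition diag_pgf :: "'a::field \<Rightarrow> 'a \<Rightarrow> 'a \<Rightarrow> nat \<Rightarrow> 'a \<Rightarrow> 'a" where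
  "diag_pgf a b y m x = diag_gf a b y m x / diag_gf a b 1 m x"

lemma diag_pgf_add_3:
  fixes a b x y :: "'a::field"
  assumes nz: "\<And>i. a * (x + of_nat i * b) + b \<noteq> 0"
  defines "q \<equiv> \<lambda>i. a * (x + of_nat i * b) + b" and "p \<equiv> a * ((y - 1) * b)"
  shows "diag_pgf a b y (m + 3) x = diag_pgf a b y (m + 2) (x + b) +
    p / q (m + 2) * (diag_pgf a b y m (x + 2 * b) +
      (if m = 0 then 0 else p / q (m + 1) * diag_pgf a b y (m - 1) (x + 2 * b))) +
    a * b * p / (q (m + 2) * q (m + 1)) * diag_pgf a b y m (x + b)"
proof -
  define A where "A l k = diag_gf a b y l (x + of_nat k * b)" for l k
  define P where "P l k = diag_gf a b 1 l (x + of_nat k * b)" for l k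
  have pgf: "diag_pgf a b y l x = A l 0 / P l 0" "diag_pgf a b y l (x + b) = A l 1 / P l 1"
    "diag_pgf a b y l (x + 2 * b) = A l 2 / P l 2" for l
    by (simp_all add: diag_pgf_def A_def P_def)
  have q: "q i \<noteq> 0" for i using nz by (simp add: q_def)
  have P_eq: "P l k = (\<Prod>i<l. q (i + k))" for l k
    unfolding P_def diag_gf_one q_def by (simp add: algebra_simps)
  have P_Suc: "P (Suc l) k = q (l + k) * P l k"
    and P_Suc_shift: "P (Suc l) k = q k * P l (Suc k)" for l k
    unfolding P_eq
    by (simp add: mult.commute) (simp add: prod.lessThan_Suc_shift del: prod.lessThan_Suc)
  define B where "B = A m 2 + (if m = 0 then 0 else p * A (m - 1) 2)"
  have "A (m + 3) 0 = q 0 * (A (m + 2) 1 + q 1 * p * B + a * b * p * A m 1)"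
    unfolding A_def B_def q_def p_def using diag_gf_add_3[of a b y m x]
    by (simp add: power2_eq_square mult_ac)
  moreover have "P (m + 3) 0 = q 0 * P (m + 2) 1"
    using P_Suc_shift[of "m + 2" 0] by (simp add: eval_nat_numeral)
  ultimately have "A (m + 3) 0 / P (m + 3) 0 =
    A (m + 2) 1 / P (m + 2) 1 + q 1 * p * B / P (m + 2) 1 + a * b * p * A m 1 / P (m + 2) 1"
    using q[of 0] by (simp add: add_divide_distrib)
  also have "q 1 * p * B / P (m + 2) 1 = p / q (m + 2) * (B / P m 2)"
    using P_Suc_shift[of "m + 1" 1] P_Suc[of m 2] q[of 1] by (simp add: eval_nat_numeral)
  also have "B / P m 2 = A m 2 / P m 2 +
    (if m = 0 then 0 else p / q (m + 1) * (A (m - 1) 2 / P (m - 1) 2))"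
    unfolding B_def by (cases m) (simp_all add: P_Suc add_divide_distrib)
  also have "a * b * p * A m 1 / P (m + 2) 1 =
    a * b * p / (q (m + 2) * q (m + 1)) * (A m 1 / P m 1)"
    using P_Suc[of "m + 1" 1] P_Suc[of m 1] by (simp add: eval_nat_numeral)
  finally show ?thesis unfolding pgf .
qed

section \<open>The limit of the recurrence\<close>

lemma norm_exp_diff_le:
  fixes z w :: "'a::{banach,real_normed_field}"
  assumes "norm z \<le> R" "norm w \<le> R"
  shows "norm (exp z - exp w) \<le> exp R * norm (z - w)"
proof (rule field_differentiable_bound[of "cball 0 R"])
  show "(exp has_field_derivative exp x) (at x within cball 0 R)" for x :: 'a
    by (rule DERIV_subset[OF DERIV_exp]) simp
  show "norm (exp x) \<le> exp R" if "x \<in> cball 0 R" for x :: 'a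
    using that by (intro order_trans[OF norm_exp]) simp
qed (use assms in simp_all)

lemma norm_exp_minus_linear_le:
  fixes z :: "'a::{banach,real_normed_field}"
  shows "norm (exp z - 1 - z) \<le> exp (norm z) * (norm z)\<^sup>2"
  using Taylor_exp_field[of z 1] by (simp add: power2_eq_square diff_diff_eq)

text \<open>At \<open>s = 0\<close> the truncated difference counts \<open>d 0 (k + 2)\<close> twice, which is harmless in the upper
  bounds below.\<close>

definition lag_sum :: "(nat \<Rightarrow> nat \<Rightarrow> real) \<Rightarrow> nat \<Rightarrow> nat \<Rightarrow> real" where
  "lag_sum d s k = d s (k + 2) + d (s - 1) (k + 2) + d s (k + 1)"

lemma lag_sum_mono:
  assumes "\<And>j l. d j l \<le> d' j l"
  shows "lag_sum d s k \<le> lag_sum d' s k"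
  unfolding lag_sum_def by (intro add_mono assms)

lemma recurrence_geometric_bound:
  fixes d :: "nat \<Rightarrow> nat \<Rightarrow> real"
  assumes nonneg: "E \<ge> 0" "p \<ge> 0" "r \<ge> 0"
    and base: "\<And>s k. s \<le> 2 \<Longrightarrow> n \<le> s + 3 * k \<Longrightarrow> d s k \<le> E"
    and step: "\<And>s k. n \<le> s + 3 * k + 3 \<Longrightarrow>
      d (s + 3) k \<le> d (s + 2) (k + 1) + p * lag_sum d s k + r * E"
  shows "n \<le> s + 3 * k \<Longrightarrow> d s k \<le> E * (1 + 3 * p + r) ^ s"
proof (induction s arbitrary: k rule: less_induct)
  case (less s)
  define q where "q = 1 + 3 * p + r"
  have q: "q \<ge> 1" using nonneg by (simp add: q_def)
  have E_le: "E \<le> E * q ^ j" for j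
    using mult_left_mono[OF one_le_power[OF q] nonneg(1)] by simp
  show ?case
  proof (cases "s \<le> 2")
    case True
    then show ?thesis using base[OF True less.prems] E_le[of s] by (simp add: q_def)
  next
    case False
    define t where "t = s - 3"
    with False have s: "s = t + 3" by simp
    define M where "M = E * q ^ (t + 2)"
    have IH: "d j l \<le> M" if "j \<le> t + 2" "n \<le> j + 3 * l" for j l
    proof -
      have "d j l \<le> E * q ^ j" using less.IH[of j l] that s by (simp add: q_def)
      also have "\<dots> \<le> M"
        unfolding M_def using that q nonneg by (intro mult_left_mono power_increasing) auto
      finally show ?thesis .
    qed
    have "d s k \<le> d (t + 2) (k + 1) + p * lag_sum d t k + r * E"
      using step[of t k] less.prems s by simp
    also have "\<dots> \<le> M + p * (M + M + M) + r * M"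
      using less.prems s nonneg E_le[of "t + 2"] unfolding lag_sum_def
      by (intro add_mono mult_left_mono IH) (auto simp: M_def)
    also have "\<dots> = E * q ^ s"
      by (simp add: s M_def q_def algebra_simps eval_nat_numeral)
    finally show ?thesis by (simp add: q_def)
  qed
qed

text \<open>The recurrence started at \<open>(n, 0)\<close> never leaves the region \<open>n \<le> s + 3 k\<close>, where
  \<open>s + k \<ge> n / 3\<close>, so that all error terms are comparable to powers of \<open>1 / n\<close>.\<close>

lemma recurrence_decay:
  fixes d :: "nat \<Rightarrow> nat \<Rightarrow> real"
  assumes nonneg: "L \<ge> 0" "Q \<ge> 0" "B \<ge> 0" "\<And>s k. d s k \<ge> 0"
    and base: "\<And>s k. s \<le> 2 \<Longrightarrow> d s k \<le> B / real (s + k)"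
    and step: "\<And>s k. d (s + 3) k \<le> d (s + 2) (k + 1) + L / real (s + k + 3) * lag_sum d s k +
      Q / (real (s + k + 3))\<^sup>2"
    and n: "n \<ge> 1"
  shows "d n 0 \<le> (9 * Q + 3 * B) * exp (9 * L + 1) / n"
proof -
  define C where "C = 9 * Q + 3 * B"
  have C: "C \<ge> 0" using nonneg by (simp add: C_def)
  have "d n 0 \<le> C / n * (1 + 3 * (3 * L / n) + 1 / n) ^ n"
  proof (rule recurrence_geometric_bound[where n = n])
    fix s k
    show "d s k \<le> C / n" if "s \<le> 2" "n \<le> s + 3 * k"
    proof -
      have "d s k \<le> B / real (s + k)" by (rule base[OF that(1)])
      also have "\<dots> \<le> B / (n / 3)"
        using that n nonneg by (intro divide_left_mono mult_pos_pos) auto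
      also have "\<dots> \<le> C / n" using nonneg n by (simp add: C_def divide_simps)
      finally show ?thesis .
    qed
    assume region: "n \<le> s + 3 * k + 3"
    define N where "N = real (s + k + 3)"
    have N: "N \<ge> n / 3" "N > 0" using region by (simp_all add: N_def)
    have lag: "lag_sum d s k \<ge> 0" using nonneg(4) by (simp add: lag_sum_def)
    have "L / N \<le> L / (n / 3)" using N n nonneg by (intro divide_left_mono) auto
    from mult_right_mono[OF this lag]
    have linear: "L / N * lag_sum d s k \<le> 3 * L / n * lag_sum d s k" by (simp add: mult_ac)
    have "Q / N\<^sup>2 \<le> Q / (n / 3)\<^sup>2"
      using N n nonneg by (intro divide_left_mono power_mono) auto
    also have "\<dots> = 9 * Q / n / n" by (simp add: power2_eq_square)
    also have "\<dots> \<le> C / n / n" using nonneg by (intro divide_right_mono) (auto simp: C_def)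
    finally have "Q / N\<^sup>2 \<le> 1 / n * (C / n)" by simp
    with step[of s k] linear
    show "d (s + 3) k \<le> d (s + 2) (k + 1) + 3 * L / n * lag_sum d s k + 1 / n * (C / n)"
      by (simp add: N_def)
  qed (use nonneg C in auto)
  also have "1 + 3 * (3 * L / n) + 1 / n = 1 + (9 * L + 1) / n" by (simp add: add_divide_distrib)
  also have "C / n * (1 + (9 * L + 1) / n) ^ n \<le> C / n * exp (9 * L + 1)"
    using nonneg n C by (intro mult_left_mono exp_ge_one_plus_x_over_n_power_n) auto
  finally show ?thesis by (simp add: C_def)
qed

definition recurrence_defect ::
    "'a::real_normed_field \<Rightarrow> (nat \<Rightarrow> nat \<Rightarrow> 'a) \<Rightarrow> nat \<Rightarrow> nat \<Rightarrow> 'a" where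
  "recurrence_defect \<eta> g s k =
    g (s + 3) k - g (s + 2) (k + 1) - \<eta> / of_nat (s + k + 3) * g s (k + 2)"

lemma recurrence_defect_diff:
  "recurrence_defect \<eta> (\<lambda>s k. g s k - h s k) s k =
    recurrence_defect \<eta> g s k - recurrence_defect \<eta> h s k"
  by (simp add: recurrence_defect_def right_diff_distrib diff_divide_distrib)

lemma norm_le_recurrence_defect:
  "norm (g (s + 3) k) \<le> norm (g (s + 2) (k + 1)) +
    norm \<eta> / real (s + k + 3) * norm (g s (k + 2)) + norm (recurrence_defect \<eta> g s k)"
proof -
  have "g (s + 3) k =
    g (s + 2) (k + 1) + \<eta> / of_nat (s + k + 3) * g s (k + 2) + recurrence_defect \<eta> g s k"
    by (simp add: recurrence_defect_def)
  also have "norm \<dots> \<le> norm (g (s + 2) (k + 1)) + norm (\<eta> / of_nat (s + k + 3) * g s (k + 2)) +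
    norm (recurrence_defect \<eta> g s k)"
    by (intro norm_triangle_mono order_refl)
  finally show ?thesis
    by (simp only: norm_mult norm_divide norm_of_nat)
qed

definition exp_profile :: "'a::{banach,real_normed_field} \<Rightarrow> nat \<Rightarrow> nat \<Rightarrow> 'a" where
  "exp_profile \<eta> s k = exp (\<eta> * of_real (real s / real (s + k)))"

lemma norm_mult_of_real_le:
  fixes \<eta> :: "'a::real_normed_field"
  assumes "0 \<le> r" "r \<le> 1"
  shows "norm (\<eta> * of_real r) \<le> norm \<eta>"
  using assms by (simp add: norm_mult mult_left_le)

lemma norm_exp_profile_le: "norm (exp_profile \<eta> s k) \<le> exp (norm \<eta>)"
  unfolding exp_profile_def
  by (intro order_trans[OF norm_exp] iffD2[OF exp_le_cancel_iff] norm_mult_of_real_le)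
    (simp_all add: divide_simps)

lemma norm_exp_profile_minus_one_le:
  assumes "s \<le> 2"
  shows "norm (exp_profile \<eta> s k - 1) \<le> 2 * exp (norm \<eta>) * norm \<eta> / real (s + k)"
proof -
  have "norm (\<eta> * of_real (real s / real (s + k))) \<le> norm \<eta>"
    by (intro norm_mult_of_real_le) (simp_all add: divide_simps)
  from norm_exp_diff_le[OF this, of 0]
  have "norm (exp_profile \<eta> s k - 1) \<le> exp (norm \<eta>) * norm (\<eta> * of_real (real s / real (s + k)))"
    unfolding exp_profile_def by (simp only: norm_zero norm_ge_zero exp_zero diff_zero)
  also have "\<dots> = exp (norm \<eta>) * norm \<eta> * real s / real (s + k)"
    by (simp add: norm_mult del: of_real_divide)
  also have "\<dots> \<le> exp (norm \<eta>) * norm \<eta> * 2 / real (s + k)"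
    using assms by (intro divide_right_mono mult_left_mono) auto
  finally show ?thesis by (simp add: mult_ac)
qed

lemma norm_exp_profile_shift_diff_le:
  "norm (exp_profile \<eta> (s + 2) (k + 1) - exp_profile \<eta> s (k + 2)) \<le>
    3 * exp (norm \<eta>) * norm \<eta> / real (s + k + 3)"
proof -
  define N where "N = real (s + k + 3)"
  define \<delta> where "\<delta> = (real s + 2) / N - real s / (N - 1)"
  have N: "N \<ge> 3" "real s + 2 < N" by (simp_all add: N_def)
  have \<delta>_eq: "\<delta> = (2 * N - real s - 2) / (N * (N - 1))"
    using N by (simp add: \<delta>_def divide_simps) (simp add: algebra_simps)
  have "\<delta> \<ge> 0" unfolding \<delta>_eq using N by (intro divide_nonneg_pos) auto
  moreover have "\<delta> \<le> 2 * N / (N * (N - 1))"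
    unfolding \<delta>_eq using N by (intro divide_right_mono) auto
  moreover have "2 * N / (N * (N - 1)) \<le> 3 / N"
    using N by (simp add: divide_simps)
  ultimately have \<delta>: "\<bar>\<delta>\<bar> \<le> 3 / N" by linarith
  define t where "t = \<eta> * of_real (real (s + 2) / real (s + 2 + (k + 1)))"
  define t' where "t' = \<eta> * of_real (real s / real (s + (k + 2)))"
  have "norm (exp t - exp t') \<le> exp (norm \<eta>) * norm (t - t')"
    unfolding t_def t'_def
    by (intro norm_exp_diff_le norm_mult_of_real_le) (auto simp: divide_simps)
  also have "t - t' = \<eta> * of_real \<delta>"
    by (simp add: t_def t'_def \<delta>_def N_def algebra_simps)
  also have "exp (norm \<eta>) * norm (\<eta> * of_real \<delta>) \<le> exp (norm \<eta>) * (norm \<eta> * (3 / N))"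
    unfolding norm_mult norm_of_real using \<delta> by (intro mult_left_mono) auto
  finally show ?thesis by (simp add: exp_profile_def t_def t'_def N_def mult_ac)
qed

lemma norm_recurrence_defect_exp_profile_le:
  fixes \<eta> :: "'a::{banach,real_normed_field}"
  shows "norm (recurrence_defect \<eta> (exp_profile \<eta>) s k) \<le>
    ((exp (norm \<eta>) * norm \<eta>)\<^sup>2 + 3 * exp (norm \<eta>) * (norm \<eta>)\<^sup>2) / (real (s + k + 3))\<^sup>2"
proof -
  define N where "N = real (s + k + 3)"
  define e where "e = norm \<eta>"
  define z where "z = \<eta> / of_nat (s + k + 3)"
  define h where "h = exp_profile \<eta>"
  have N: "N \<ge> 1" by (simp add: N_def)
  have z_eq: "\<eta> * of_real (1 / N) = z" by (simp add: z_def N_def)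
  have z: "norm z = e / N" "norm z \<le> e"
    using N norm_mult_of_real_le[of "1 / N" \<eta>] unfolding z_eq
    by (simp_all add: z_def e_def N_def norm_divide del: of_nat_add)
  have "real (s + 3) / real (s + 3 + k) = real (s + 2) / real (s + 2 + (k + 1)) + 1 / N"
    by (simp add: N_def add_divide_distrib[symmetric] add_ac)
  then have h_Suc: "h (s + 3) k = h (s + 2) (k + 1) * exp z"
    unfolding h_def exp_profile_def z_eq[symmetric] by (simp only: of_real_add distrib_left exp_add)
  have "norm (exp z - 1 - z) \<le> exp (norm z) * (norm z)\<^sup>2" by (rule norm_exp_minus_linear_le)
  also have "\<dots> \<le> exp e * (e / N)\<^sup>2"
    unfolding z(1)[symmetric] using z(2) by (intro mult_right_mono) auto
  finally have quadratic: "norm (h (s + 2) (k + 1) * (exp z - 1 - z)) \<le> exp e * (exp e * (e / N)\<^sup>2)"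
    unfolding norm_mult h_def e_def by (intro mult_mono norm_exp_profile_le) auto
  have shift: "norm (z * (h (s + 2) (k + 1) - h s (k + 2))) \<le> e / N * (3 * exp e * e / N)"
    unfolding norm_mult z(1) h_def e_def N_def
    by (intro mult_left_mono norm_exp_profile_shift_diff_le) auto
  have "recurrence_defect \<eta> h s k =
    h (s + 2) (k + 1) * (exp z - 1 - z) + z * (h (s + 2) (k + 1) - h s (k + 2))"
    unfolding recurrence_defect_def z_def[symmetric] h_Suc by (simp add: algebra_simps)
  also have "norm \<dots> \<le> exp e * (exp e * (e / N)\<^sup>2) + e / N * (3 * exp e * e / N)"
    using quadratic shift by (rule norm_triangle_mono)
  also have "\<dots> = ((exp e * e)\<^sup>2 + 3 * exp e * e\<^sup>2) / N\<^sup>2"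
    by (simp add: power2_eq_square add_divide_distrib mult_ac)
  finally show ?thesis unfolding h_def e_def N_def .
qed

lemma approximate_recurrence_error:
  fixes g h :: "nat \<Rightarrow> nat \<Rightarrow> 'a::real_normed_field"
  assumes K: "K \<ge> 0"
    and g: "\<And>s k. norm (recurrence_defect \<eta> g s k) \<le>
      K / (real (s + k + 3))\<^sup>2 * lag_sum (\<lambda>s k. norm (g s k)) s k"
    and h: "\<And>s k. norm (recurrence_defect \<eta> h s k) \<le> Q / (real (s + k + 3))\<^sup>2"
    and h_le: "\<And>s k. norm (h s k) \<le> H"
  defines "d \<equiv> \<lambda>s k. norm (g s k - h s k)"
  shows "d (s + 3) k \<le> d (s + 2) (k + 1) + (norm \<eta> + K) / real (s + k + 3) * lag_sum d s k +
    (Q + 3 * K * H) / (real (s + k + 3))\<^sup>2"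
proof -
  define N where "N = real (s + k + 3)"
  define D where "D = lag_sum d s k"
  have N: "N \<ge> 1" by (simp add: N_def)
  have D: "D \<ge> 0" "d s (k + 2) \<le> D" by (simp_all add: D_def d_def lag_sum_def)
  have "norm (g i j) \<le> d i j + H" for i j
    using norm_triangle_sub[of "g i j" "h i j"] h_le[of i j] by (simp add: d_def)
  then have "lag_sum (\<lambda>s k. norm (g s k)) s k \<le> lag_sum (\<lambda>i j. d i j + H) s k"
    by (rule lag_sum_mono)
  also have "\<dots> = D + 3 * H" by (simp add: lag_sum_def D_def)
  finally have "K / N\<^sup>2 * lag_sum (\<lambda>s k. norm (g s k)) s k \<le> K / N\<^sup>2 * (D + 3 * H)"
    using K by (intro mult_left_mono) auto
  also have "\<dots> \<le> K / N * D + 3 * K * H / N\<^sup>2"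
  proof -
    have "K / N\<^sup>2 \<le> K / N" using K N by (intro divide_left_mono) (auto simp: power2_eq_square)
    from mult_right_mono[OF this D(1)] show ?thesis
      by (simp add: distrib_left add_divide_distrib mult_ac)
  qed
  finally have "norm (recurrence_defect \<eta> g s k) \<le> K / N * D + 3 * K * H / N\<^sup>2"
    using g[of s k] by (simp add: N_def)
  then have defect: "norm (recurrence_defect \<eta> (\<lambda>s k. g s k - h s k) s k) \<le>
    K / N * D + 3 * K * H / N\<^sup>2 + Q / N\<^sup>2"
    unfolding recurrence_defect_diff N_def
    by (intro order_trans[OF norm_triangle_ineq4] add_mono h)
  have "d (s + 3) k \<le> d (s + 2) (k + 1) + norm \<eta> / N * d s (k + 2) +
    norm (recurrence_defect \<eta> (\<lambda>s k. g s k - h s k) s k)"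
    unfolding d_def N_def by (rule norm_le_recurrence_defect)
  also have "\<dots> \<le> d (s + 2) (k + 1) + norm \<eta> / N * D + (K / N * D + 3 * K * H / N\<^sup>2 + Q / N\<^sup>2)"
    using N D defect by (intro add_mono mult_left_mono order_refl) auto
  finally show ?thesis by (simp add: D_def N_def add_divide_distrib algebra_simps)
qed

lemma approximate_recurrence_tendsto_exp:
  fixes g :: "nat \<Rightarrow> nat \<Rightarrow> 'a::{banach,real_normed_field}"
  assumes K: "K \<ge> 0"
    and base: "\<And>s k. s \<le> 2 \<Longrightarrow> g s k = 1"
    and rec: "\<And>s k. norm (recurrence_defect \<eta> g s k) \<le>
      K / (real (s + k + 3))\<^sup>2 * lag_sum (\<lambda>s k. norm (g s k)) s k"
  shows "(\<lambda>n. g n 0) \<longlonglongrightarrow> exp \<eta>"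
proof -
  define e where "e = norm \<eta>"
  define d where "d s k = norm (g s k - exp_profile \<eta> s k)" for s k
  define Q where "Q = (exp e * e)\<^sup>2 + 3 * exp e * e\<^sup>2 + 3 * K * exp e"
  define B where "B = 2 * exp e * e"
  define C where "C = (9 * Q + 3 * B) * exp (9 * (e + K) + 1)"
  have bound: "norm (g n 0 - exp \<eta>) \<le> C / n" if n: "n \<ge> 1" for n
  proof -
    have "d n 0 \<le> C / n"
      unfolding C_def
    proof (rule recurrence_decay[OF _ _ _ _ _ _ n])
      show "d s k \<le> B / real (s + k)" if "s \<le> 2" for s k
        using norm_exp_profile_minus_one_le[OF that, of \<eta> k] base[OF that]
        by (simp add: d_def B_def e_def norm_minus_commute)
      show "d (s + 3) k \<le> d (s + 2) (k + 1) + (e + K) / real (s + k + 3) * lag_sum d s k +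
          Q / (real (s + k + 3))\<^sup>2" for s k
        unfolding d_def Q_def e_def
        by (rule approximate_recurrence_error[OF K rec norm_recurrence_defect_exp_profile_le
              norm_exp_profile_le])
    qed (use K in \<open>auto simp: d_def Q_def B_def e_def\<close>)
    then show ?thesis using n by (simp add: d_def exp_profile_def)
  qed
  have "(\<lambda>n. g n 0 - exp \<eta>) \<longlonglongrightarrow> 0"
  proof (rule Lim_null_comparison)
    show "\<forall>\<^sub>F n in sequentially. norm (g n 0 - exp \<eta>) \<le> C / n"
      by (intro eventually_sequentiallyI[of 1] bound)
    show "(\<lambda>n. C / real n) \<longlonglongrightarrow> 0" by (rule lim_const_over_n)
  qed
  then show ?thesis by (rule LIM_zero_cancel)
qed

section \<open>Convergence of the generating functions\<close>

lemma diag_factor_eq: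
  assumes "\<alpha> > 0" "\<beta> > 0"
  shows "of_real \<alpha> * (1 + of_nat k * of_real \<beta> + of_nat i * of_real \<beta>) + of_real \<beta> =
    (of_real (\<alpha> * \<beta> * (1 / \<alpha> + 1 / \<beta> + real (k + i))) :: 'a::real_field)"
proof -
  have "\<alpha> * (1 + real k * \<beta> + real i * \<beta>) + \<beta> = \<alpha> * \<beta> * (1 / \<alpha> + 1 / \<beta> + real (k + i))"
    using assms by (simp add: field_simps)
  from arg_cong[OF this, of "of_real :: real \<Rightarrow> 'a"] show ?thesis by simp
qed

lemma diag_factor_nonzero:
  assumes "\<alpha> > 0" "\<beta> > 0"
  shows "of_real \<alpha> * (1 + of_nat k * of_real \<beta> + of_nat i * of_real \<beta>) + of_real \<beta> \<noteq>
    (0 :: 'a::real_field)"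
proof -
  have "0 < \<alpha> * \<beta> * (1 / \<alpha> + 1 / \<beta> + real (k + i))"
    using assms by (intro mult_pos_pos add_pos_nonneg add_pos_pos) auto
  then show ?thesis unfolding diag_factor_eq[OF assms] of_real_eq_0_iff
    by (rule less_imp_neq[symmetric])
qed

definition shifted_pgf :: "real \<Rightarrow> real \<Rightarrow> 'a::real_field \<Rightarrow> nat \<Rightarrow> nat \<Rightarrow> 'a" where
  "shifted_pgf \<alpha> \<beta> y s k = diag_pgf (of_real \<alpha>) (of_real \<beta>) y s (1 + of_nat k * of_real \<beta>)"

lemma shifted_pgf_small:
  fixes y :: "'a::real_field"
  assumes "\<alpha> > 0" "\<beta> > 0" "s \<le> 2"
  shows "shifted_pgf \<alpha> \<beta> y s k = 1"
proof -
  have "diag_gf (of_real \<alpha>) (of_real \<beta>) 1 s (1 + of_nat k * of_real \<beta>) \<noteq> (0 :: 'a)"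
    unfolding diag_gf_one prod_zero_iff[OF finite_lessThan]
    using diag_factor_nonzero[OF assms(1,2)] by blast
  then show ?thesis
    unfolding shifted_pgf_def diag_pgf_def diag_gf_small[OF assms(3), where y = y]
    by (rule divide_self)
qed

lemma shifted_pgf_recurrence:
  fixes y :: "'a::real_field" and s k :: nat
  assumes "\<alpha> > 0" "\<beta> > 0"
  defines "g \<equiv> shifted_pgf \<alpha> \<beta> y"
    and "m \<equiv> 1 / \<alpha> + 1 / \<beta> + real (s + k + 1)"
  shows "g (s + 3) k = g (s + 2) (k + 1) + (y - 1) / of_real (m + 1) *
      (g s (k + 2) + (if s = 0 then 0 else (y - 1) / of_real m * g (s - 1) (k + 2))) +
    (y - 1) / of_real (m * (m + 1)) * g s (k + 1)"
proof -
  let ?a = "of_real \<alpha> :: 'a" and ?b = "of_real \<beta> :: 'a"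
  let ?x = "1 + of_nat k * ?b"
  have factor: "?a * (?x + of_nat (s + 2) * ?b) + ?b = of_real (\<alpha> * \<beta> * (m + 1))"
    "?a * (?x + of_nat (s + 1) * ?b) + ?b = of_real (\<alpha> * \<beta> * m)"
    unfolding diag_factor_eq[OF assms(1,2)] by (simp_all add: m_def add_ac)
  have shift: "?x + ?b = 1 + of_nat (k + 1) * ?b" "?x + 2 * ?b = 1 + of_nat (k + 2) * ?b"
    by (simp_all add: algebra_simps)
  have cancel: "?a * ((y - 1) * ?b) / of_real (\<alpha> * \<beta> * t) = (y - 1) / of_real t"
    "?a * ?b * (?a * ((y - 1) * ?b)) / (of_real (\<alpha> * \<beta> * (m + 1)) * of_real (\<alpha> * \<beta> * m)) =
      (y - 1) / of_real (m * (m + 1))" for t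
    using assms(1,2) by (simp_all add: mult_ac)
  show ?thesis
    using diag_pgf_add_3[where x = ?x and m = s and y = y, OF diag_factor_nonzero[OF assms(1,2)]]
    unfolding factor shift cancel g_def shifted_pgf_def .
qed

lemma inverse_shift_bounds:
  fixes c N :: real
  assumes c: "c > 0" and N: "N \<ge> 3"
  shows "\<bar>1 / (c + N - 1) - 1 / N\<bar> \<le> (1 + c) * (9 / N\<^sup>2)"
    and "1 / ((c + N - 2) * (c + N - 1)) \<le> 9 / N\<^sup>2"
proof -
  have ge: "N / 3 \<le> c + N - 1" "N / 3 \<le> c + N - 2" "N / 3 \<le> N" using assms by auto
  have "1 / (c + N - 1) - 1 / N = (1 - c) / ((c + N - 1) * N)"
    using assms by (simp add: divide_simps)
  also have "\<bar>\<dots>\<bar> \<le> (1 + c) / (N / 3 * (N / 3))"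
    unfolding abs_divide abs_mult using assms ge by (intro frac_le mult_mono mult_pos_pos) auto
  finally show "\<bar>1 / (c + N - 1) - 1 / N\<bar> \<le> (1 + c) * (9 / N\<^sup>2)"
    by (simp add: power2_eq_square)
  have "1 / ((c + N - 2) * (c + N - 1)) \<le> 1 / (N / 3 * (N / 3))"
    using assms ge by (intro divide_left_mono mult_mono mult_pos_pos) auto
  then show "1 / ((c + N - 2) * (c + N - 1)) \<le> 9 / N\<^sup>2" by (simp add: power2_eq_square)
qed

lemma recurrence_coefficient_bounds:
  fixes \<eta> :: "'a::real_normed_field"
  assumes c: "c > 0" and N: "N \<ge> 3"
  defines "r \<equiv> 9 * (1 + c) * (norm \<eta> + (norm \<eta>)\<^sup>2) / N\<^sup>2"
  shows "norm (\<eta> * of_real (1 / (c + N - 1) - 1 / N)) \<le> r"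
    and "norm (\<eta> * of_real (1 / ((c + N - 2) * (c + N - 1)))) \<le> r"
    and "norm (\<eta>\<^sup>2 * of_real (1 / ((c + N - 2) * (c + N - 1)))) \<le> r"
proof -
  define e where "e = norm \<eta>"
  have e: "e \<ge> 0" by (simp add: e_def)
  have le_r: "norm (\<zeta> * of_real t) \<le> r"
    if \<zeta>: "norm \<zeta> * b \<le> (1 + c) * (e + e\<^sup>2)" and t: "\<bar>t\<bar> \<le> b * (9 / N\<^sup>2)" for \<zeta> :: 'a and b t
  proof -
    have "norm (\<zeta> * of_real t) \<le> norm \<zeta> * (b * (9 / N\<^sup>2))"
      unfolding norm_mult norm_of_real using t by (intro mult_left_mono) auto
    also have "\<dots> \<le> (1 + c) * (e + e\<^sup>2) * (9 / N\<^sup>2)"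
      unfolding mult.assoc[symmetric, of "norm \<zeta>"] using \<zeta> by (intro mult_right_mono) auto
    also have "\<dots> = r" by (simp only: r_def e_def mult_ac times_divide_eq_right)
    finally show ?thesis .
  qed
  show "norm (\<eta> * of_real (1 / (c + N - 1) - 1 / N)) \<le> r"
    using c e by (intro le_r[OF _ inverse_shift_bounds(1)[OF c N]]) (simp add: e_def mult.commute)
  have t: "\<bar>1 / ((c + N - 2) * (c + N - 1))\<bar> \<le> 1 * (9 / N\<^sup>2)"
    using inverse_shift_bounds(2)[OF c N] c N by simp
  show "norm (\<eta> * of_real (1 / ((c + N - 2) * (c + N - 1)))) \<le> r"
    using c e by (intro le_r[OF _ t]) (simp add: algebra_simps flip: e_def)
  show "norm (\<eta>\<^sup>2 * of_real (1 / ((c + N - 2) * (c + N - 1)))) \<le> r"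
    using c e by (intro le_r[OF _ t]) (simp add: norm_power algebra_simps flip: e_def)
qed

lemma norm_recurrence_defect_shifted_pgf_le:
  fixes y :: "'a::real_normed_field"
  assumes "\<alpha> > 0" "\<beta> > 0"
  defines "g \<equiv> shifted_pgf \<alpha> \<beta> y"
    and "\<eta> \<equiv> y - 1" and "c \<equiv> 1 / \<alpha> + 1 / \<beta>"
  shows "norm (recurrence_defect \<eta> g s k) \<le>
    9 * (1 + c) * (norm \<eta> + (norm \<eta>)\<^sup>2) / (real (s + k + 3))\<^sup>2 *
    lag_sum (\<lambda>s k. norm (g s k)) s k"
proof -
  define N where "N = real (s + k + 3)"
  define m where "m = c + real (s + k + 1)"
  define r where "r = 9 * (1 + c) * (norm \<eta> + (norm \<eta>)\<^sup>2) / N\<^sup>2"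
  define u where "u = \<eta> * of_real (1 / (m + 1) - 1 / N)"
  define v where "v = (if s = 0 then 0 else \<eta>\<^sup>2 * of_real (1 / (m * (m + 1))))"
  define w where "w = \<eta> * of_real (1 / (m * (m + 1)))"
  have c: "c > 0" using assms by (simp add: c_def add_pos_pos)
  have N: "N \<ge> 3" and m: "c + N - 1 = m + 1" "c + N - 2 = m" by (auto simp: N_def m_def)
  have "r \<ge> 0" using c by (simp add: r_def)
  note bounds = recurrence_coefficient_bounds[OF c N, of \<eta>, folded r_def, unfolded m]
  have coeff_le: "norm u \<le> r" "norm v \<le> r" "norm w \<le> r"
    using bounds \<open>r \<ge> 0\<close> unfolding u_def v_def w_def by simp_all
  have coeff: "u = \<eta> / of_real (m + 1) - \<eta> / of_nat (s + k + 3)"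
    "v = \<eta> / of_real (m + 1) * (if s = 0 then 0 else \<eta> / of_real m)"
    "w = \<eta> / of_real (m * (m + 1))"
    by (simp_all add: u_def v_def w_def N_def right_diff_distrib power2_eq_square)
  have rec: "g (s + 3) k = g (s + 2) (k + 1) + \<eta> / of_real (m + 1) *
      (g s (k + 2) + (if s = 0 then 0 else \<eta> / of_real m * g (s - 1) (k + 2))) +
    \<eta> / of_real (m * (m + 1)) * g s (k + 1)"
    unfolding g_def \<eta>_def m_def c_def by (rule shifted_pgf_recurrence[OF assms(1,2)])
  have "recurrence_defect \<eta> g s k = u * g s (k + 2) + v * g (s - 1) (k + 2) + w * g s (k + 1)"
    unfolding recurrence_defect_def rec coeff by (simp add: distrib_left left_diff_distrib)
  also have "norm \<dots> \<le>
    r * norm (g s (k + 2)) + r * norm (g (s - 1) (k + 2)) + r * norm (g s (k + 1))"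
    using coeff_le by (intro norm_triangle_mono) (simp_all add: norm_mult mult_right_mono)
  finally show ?thesis by (simp only: r_def N_def lag_sum_def distrib_left)
qed

lemma diag_pgf_tendsto_exp:
  fixes y :: "'a::{banach,real_normed_field}"
  assumes "\<alpha> > 0" "\<beta> > 0"
  shows "(\<lambda>n. diag_pgf (of_real \<alpha>) (of_real \<beta>) y n 1) \<longlonglongrightarrow> exp (y - 1)"
proof -
  have "(\<lambda>n. shifted_pgf \<alpha> \<beta> y n 0) \<longlonglongrightarrow> exp (y - 1)"
    using assms
    by (intro approximate_recurrence_tendsto_exp[OF _ shifted_pgf_small
          norm_recurrence_defect_shifted_pgf_le]) auto
  then show ?thesis by (simp add: shifted_pgf_def)
qed

section \<open>Characteristic functions\<close>

lemma diag_gf_at_one: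
  "diag_gf (of_real \<alpha>) (of_real \<beta>) y n 1 =
    (\<Sum>T\<in>ab_staircases n. of_real (wt n \<alpha> \<beta> T) * y ^ X3 n T :: 'a::{real_algebra_1,comm_ring_1})"
  by (simp add: diag_gf_def stair_gf_def stair_weight_def wt_def)

lemma of_real_Z_eq:
  "of_real (Z n \<alpha> \<beta>) = (diag_gf (of_real \<alpha>) (of_real \<beta>) 1 n 1 :: 'a::{real_algebra_1,comm_ring_1})"
  by (simp add: diag_gf_at_one Z_def)

lemma Z_pos:
  assumes "\<alpha> > 0" "\<beta> > 0"
  shows "Z n \<alpha> \<beta> > 0"
proof -
  have "Z n \<alpha> \<beta> = (\<Prod>i<n. \<alpha> * (1 + real i * \<beta>) + \<beta>)"
    using of_real_Z_eq[of n \<alpha> \<beta>, where 'a = real] by (simp add: diag_gf_one)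
  then show ?thesis
    using assms by (auto intro!: prod_pos add_pos_pos mult_pos_pos add_pos_nonneg)
qed

lemma pmf_stair_pmf:
  assumes "\<alpha> > 0" "\<beta> > 0"
  shows "pmf (stair_pmf n \<alpha> \<beta>) T = (if T \<in> ab_staircases n then wt n \<alpha> \<beta> T / Z n \<alpha> \<beta> else 0)"
  unfolding stair_pmf_def
proof (rule pmf_embed_pmf)
  let ?f = "\<lambda>T. if T \<in> ab_staircases n then wt n \<alpha> \<beta> T / Z n \<alpha> \<beta> else 0"
  have "wt n \<alpha> \<beta> T \<ge> 0" for T using assms by (simp add: wt_def)
  then show nonneg: "0 \<le> ?f T" for T using Z_pos[OF assms, of n] by simp
  have "(\<integral>\<^sup>+T. ennreal (?f T) \<partial>count_space UNIV) = (\<Sum>T\<in>ab_staircases n. ennreal (?f T))"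
    by (rule nn_integral_count_space') auto
  also have "\<dots> = ennreal (\<Sum>T\<in>ab_staircases n. ?f T)"
    by (rule sum_ennreal) (rule nonneg)
  also have "(\<Sum>T\<in>ab_staircases n. ?f T) = 1"
    using Z_pos[OF assms, of n] by (simp add: sum_divide_distrib[symmetric] Z_def)
  finally show "(\<integral>\<^sup>+T. ennreal (?f T) \<partial>count_space UNIV) = 1" by simp
qed

lemma integral_stair_pmf:
  fixes f :: "filling \<Rightarrow> 'a::{banach,second_countable_topology}"
  assumes "\<alpha> > 0" "\<beta> > 0"
  shows "(\<integral>T. f T \<partial>measure_pmf (stair_pmf n \<alpha> \<beta>)) =
    (\<Sum>T\<in>ab_staircases n. (wt n \<alpha> \<beta> T / Z n \<alpha> \<beta>) *\<^sub>R f T)"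
proof -
  have "(\<integral>T. f T \<partial>measure_pmf (stair_pmf n \<alpha> \<beta>)) =
    (\<Sum>T\<in>ab_staircases n. pmf (stair_pmf n \<alpha> \<beta>) T *\<^sub>R f T)"
    by (rule integral_measure_pmf) (auto simp: set_pmf_eq pmf_stair_pmf[OF assms] split: if_splits)
  then show ?thesis by (simp add: pmf_stair_pmf[OF assms])
qed

lemma iexp_mult_of_nat: "iexp (t * real k) = iexp t ^ k"
  by (simp add: exp_of_nat_mult[symmetric] mult_ac)

lemma char_X3_law:
  assumes "\<alpha> > 0" "\<beta> > 0"
  shows "char (X3_law n \<alpha> \<beta>) t = diag_pgf (of_real \<alpha>) (of_real \<beta>) (iexp t) n 1"
proof -
  have "char (X3_law n \<alpha> \<beta>) t = (\<integral>T. iexp t ^ X3 n T \<partial>measure_pmf (stair_pmf n \<alpha> \<beta>))"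
    by (simp add: char_def X3_law_def flip: iexp_mult_of_nat)
  also have "\<dots> = (\<Sum>T\<in>ab_staircases n. of_real (wt n \<alpha> \<beta> T) * iexp t ^ X3 n T) / of_real (Z n \<alpha> \<beta>)"
    unfolding integral_stair_pmf[OF assms] sum_divide_distrib by (simp add: scaleR_conv_of_real)
  finally show ?thesis
    unfolding diag_pgf_def of_real_Z_eq diag_gf_at_one .
qed

lemma char_poisson:
  assumes "0 < r"
  shows "char (measure_pmf (map_pmf real (poisson_pmf r))) t = exp (of_real r * (iexp t - 1))"
proof -
  define f where "f k = pmf (poisson_pmf r) k *\<^sub>R iexp (t * real k)" for k
  have f: "f k = exp (- r) *\<^sub>R ((of_real r * iexp t) ^ k /\<^sub>R fact k)" for k
    unfolding f_def iexp_mult_of_nat pmf_poisson[OF assms]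
    by (simp add: scaleR_conv_of_real power_mult_distrib divide_inverse mult_ac)
  have f_sums: "f sums (exp (- r) *\<^sub>R exp (of_real r * iexp t))"
    unfolding f by (intro sums_scaleR_right exp_converges)
  have "summable (\<lambda>k. norm (f k))"
    using summable_mult[OF summable_exp[of r], of "exp (- r)"] assms
    by (simp add: f norm_mult norm_power mult.assoc)
  then have int: "integrable (count_space UNIV) f"
    by (simp add: integrable_count_space_nat_iff)
  have "char (measure_pmf (map_pmf real (poisson_pmf r))) t =
    (\<integral>k. iexp (t * real k) \<partial>measure_pmf (poisson_pmf r))"
    by (simp add: char_def)
  also have "\<dots> = (\<integral>k. f k \<partial>count_space UNIV)"
    unfolding measure_pmf_eq_density f_def by (rule integral_density) auto
  also have "\<dots> = suminf f" by (rule integral_count_space_nat[OF int])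
  also have "\<dots> = exp (- r) *\<^sub>R exp (of_real r * iexp t)"
    by (rule sums_unique[OF f_sums, symmetric])
  also have "\<dots> = exp (of_real r * (iexp t - 1))"
    by (simp add: scaleR_conv_of_real algebra_simps exp_diff exp_minus divide_inverse
        flip: exp_of_real)
  finally show ?thesis .
qed

text \<open>Levy's theorem asks for the Borel sigma algebra, whereas every set is measurable for
  \<^const>\<open>measure_pmf\<close>.\<close>

lemma weak_conv_m_measure_pmfI:
  fixes p :: "nat \<Rightarrow> real pmf" and q :: "real pmf"
  assumes "\<And>t. (\<lambda>n. char (measure_pmf (p n)) t) \<longlonglongrightarrow> char (measure_pmf q) t"
  shows "weak_conv_m (\<lambda>n. measure_pmf (p n)) (measure_pmf q)"
proof -
  define D where "D r = distr (measure_pmf r) borel (\<lambda>x::real. x)" for r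
  have dist: "real_distribution (D r)" for r
    unfolding real_distribution_def real_distribution_axioms_def D_def
    by (auto intro!: measure_pmf.prob_space_distr)
  have char: "char (D r) = char (measure_pmf r)" for r
    by (simp add: fun_eq_iff char_def D_def integral_distr)
  have cdf: "cdf (D r) = cdf (measure_pmf r)" for r
    by (simp add: fun_eq_iff cdf_def D_def measure_distr)
  have "weak_conv_m (\<lambda>n. D (p n)) (D q)"
    using dist assms by (intro levy_continuity) (simp_all add: char)
  then show ?thesis by (simp add: weak_conv_m_def cdf)
qed

theorem theorem4p6:
  fixes \<alpha> \<beta> :: real
  assumes "\<alpha> > 0" and "\<beta> > 0"
  shows "weak_conv_m (\<lambda>n. X3_law (n + 3) \<alpha> \<beta>)
           (measure_pmf (map_pmf real (poisson_pmf 1)))"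
proof -
  let ?poisson = "measure_pmf (map_pmf real (poisson_pmf 1))"
  have "(\<lambda>n. char (X3_law n \<alpha> \<beta>) t) \<longlonglongrightarrow> char ?poisson t" for t
    unfolding char_X3_law[OF assms] using diag_pgf_tendsto_exp[OF assms] by (simp add: char_poisson)
  then have "(\<lambda>n. char (X3_law (n + 3) \<alpha> \<beta>) t) \<longlonglongrightarrow> char ?poisson t" for t
    by (rule LIMSEQ_ignore_initial_segment)
  then show ?thesis
    unfolding X3_law_def by (rule weak_conv_m_measure_pmfI)
qed

end
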